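(* Let $a\in\mathbb{R}$ be a parameter and consider the system $$\frac{dv_0}{dt} = a\,v_0^{\frac{a+1}{a}}v_1,\qquad \frac{dv_1}{dt} = a\,v_1^{\frac{a+1}{a}}v_0$$ with initial data $v_0(0)>0$ and $v_1(0)>0$. Assume that $a<1$. If $v_0(0)=v_1(0)$, then the solution blows up with the blow-up rate $O\big((t_{\max}-t)^{\frac{-a}{a+1}}\big)$. If $v_0(0)\neq v_1(0)$, then the solution blows up with the blow-up rate $O\big((t_{\max}-t)^{-a}\big)$.
   Context: $t_{\max}$ denotes the maximal existence time of the solution. The solution blows up if $t_{\max}<\infty$ and $\max\{|v_0(t)|,|v_1(t)|\}\to\infty$ as $t\to t_{\max}-0$. It blows up with rate $O(g(t))$ if $\max\{|v_0(t)|,|v_1(t)|\} = O(g(t))$ as $t\to t_{\max}-0$.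
   Formalization: The parameter is restricted to 0 < a < 1: for a = 0 the system is undefined, and for a < 0 positive solutions are nonincreasing and never blow up (e.g. a = -1, v_0 = v_1 = e^{-t}), so the claim fails there. *)

theory Defs
  imports "HOL-Analysis.Analysis" "HOL-Library.Landau_Symbols"
begin

text \<open>
  The time horizon \<open>T\<close> is an extended real, so that global solutions (\<open>T = \<infinity>\<close>) are not
  excluded a priori. Since the exponents are real, the phase space is the open quadrant
  \<open>v\<^sub>0, v\<^sub>1 > 0\<close>. The derivative at \<open>t = 0\<close> is one-sided.
\<close>

definition solution :: "real \<Rightarrow> (real \<Rightarrow> real) \<Rightarrow> (real \<Rightarrow> real) \<Rightarrow> ereal \<Rightarrow> bool" where
  "solution a v\<^sub>0 v\<^sub>1 T \<longleftrightarrow>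
     0 < T \<and>
     (\<forall>t. 0 \<le> t \<and> ereal t < T \<longrightarrow>
        v\<^sub>0 t > 0 \<and> v\<^sub>1 t > 0 \<and>
        (v\<^sub>0 has_real_derivative a * v\<^sub>0 t powr ((a + 1) / a) * v\<^sub>1 t)
          (at t within {s. 0 \<le> s \<and> ereal s < T}) \<and>
        (v\<^sub>1 has_real_derivative a * v\<^sub>1 t powr ((a + 1) / a) * v\<^sub>0 t)
          (at t within {s. 0 \<le> s \<and> ereal s < T}))"

definition maximal_solution :: "real \<Rightarrow> (real \<Rightarrow> real) \<Rightarrow> (real \<Rightarrow> real) \<Rightarrow> ereal \<Rightarrow> bool" where
  "maximal_solution a v\<^sub>0 v\<^sub>1 T \<longleftrightarrow>
     solution a v\<^sub>0 v\<^sub>1 T \<and>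
     (\<forall>u\<^sub>0 u\<^sub>1 T'. solution a u\<^sub>0 u\<^sub>1 T' \<and>
        (\<forall>t. 0 \<le> t \<and> ereal t < T \<longrightarrow> u\<^sub>0 t = v\<^sub>0 t \<and> u\<^sub>1 t = v\<^sub>1 t) \<longrightarrow> T' \<le> T)"

definition blows_up :: "(real \<Rightarrow> real) \<Rightarrow> (real \<Rightarrow> real) \<Rightarrow> ereal \<Rightarrow> bool" where
  "blows_up v\<^sub>0 v\<^sub>1 T \<longleftrightarrow>
     T < \<infinity> \<and>
     filterlim (\<lambda>t. max \<bar>v\<^sub>0 t\<bar> \<bar>v\<^sub>1 t\<bar>) at_top (at_left (real_of_ereal T))"

definition blows_up_with_rate ::
  "(real \<Rightarrow> real) \<Rightarrow> (real \<Rightarrow> real) \<Rightarrow> ereal \<Rightarrow> (real \<Rightarrow> real) \<Rightarrow> bool" where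
  "blows_up_with_rate v\<^sub>0 v\<^sub>1 T g \<longleftrightarrow>
     blows_up v\<^sub>0 v\<^sub>1 T \<and>
     (\<lambda>t. max \<bar>v\<^sub>0 t\<bar> \<bar>v\<^sub>1 t\<bar>) \<in> O[at_left (real_of_ereal T)](g)"

text \<open>
  Blow-up can only occur for \<open>a > 0\<close>: for \<open>a \<le> 0\<close> both components are nonincreasing.
\<close>

lemma solution_not_blows_up:
  assumes sol: "solution a v\<^sub>0 v\<^sub>1 T" and a: "a \<le> 0"
  shows "\<not> blows_up v\<^sub>0 v\<^sub>1 T"
proof
  assume bu: "blows_up v\<^sub>0 v\<^sub>1 T"
  have "0 < T" "T < \<infinity>"
    using sol bu by (auto simp: solution_def blows_up_def)
  then obtain r where T: "T = ereal r" and r: "0 < r"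
    by (cases T) auto
  have pos: "v\<^sub>0 t > 0" "v\<^sub>1 t > 0" if "0 \<le> t" "t < r" for t
    using sol that by (auto simp: solution_def T)
  have der0: "(v\<^sub>0 has_real_derivative a * v\<^sub>0 t powr ((a + 1) / a) * v\<^sub>1 t) (at t within {0..<r})"
    and der1: "(v\<^sub>1 has_real_derivative a * v\<^sub>1 t powr ((a + 1) / a) * v\<^sub>0 t) (at t within {0..<r})"
    if "0 \<le> t" "t < r" for t
    using sol that by (auto simp: solution_def T atLeastLessThan_def atLeast_def lessThan_def Int_def)
  have decr: "f t \<le> f 0"
    if t: "0 < t" "t < r"
      and der: "\<And>s. \<lbrakk>0 \<le> s; s < r\<rbrakk> \<Longrightarrow> (f has_real_derivative f' s) (at s within {0..<r}) \<and> f' s \<le> 0"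
    for f f' :: "real \<Rightarrow> real" and t
  proof (rule DERIV_nonpos_imp_decreasing_open[of 0 t f])
    show "0 \<le> t" using t by simp
    have "continuous_on {0..<r} f"
      using der by (intro DERIV_continuous_on[where D = f']) auto
    then show "continuous_on {0..t} f"
      by (rule continuous_on_subset) (use t in auto)
    show "\<exists>y. (f has_real_derivative y) (at s) \<and> y \<le> 0" if s: "0 < s" "s < t" for s
    proof -
      have "(f has_real_derivative f' s) (at s within {0<..<r})"
        using der[of s] s t by (auto intro: DERIV_subset)
      moreover have "at s within {0<..<r} = at s"
        using s t by (intro at_within_open) auto
      ultimately show ?thesis using der[of s] s t by auto
    qed
  qed
  have rhs: "a * x powr p * y \<le> 0" if "y > 0" for x p y :: real
    using a that by (intro mult_nonpos_nonneg) (auto simp: mult_le_0_iff)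
  have bound: "max \<bar>v\<^sub>0 t\<bar> \<bar>v\<^sub>1 t\<bar> \<le> max (v\<^sub>0 0) (v\<^sub>1 0)" if t: "0 < t" "t < r" for t
  proof -
    have "v\<^sub>0 t \<le> v\<^sub>0 0"
      by (rule decr[OF t, where f' = "\<lambda>t. a * v\<^sub>0 t powr ((a + 1) / a) * v\<^sub>1 t"])
         (use der0 rhs pos in blast)
    moreover have "v\<^sub>1 t \<le> v\<^sub>1 0"
      by (rule decr[OF t, where f' = "\<lambda>t. a * v\<^sub>1 t powr ((a + 1) / a) * v\<^sub>0 t"])
         (use der1 rhs pos in blast)
    ultimately show ?thesis using pos[of t] t by auto
  qed
  have "eventually (\<lambda>t. max \<bar>v\<^sub>0 t\<bar> \<bar>v\<^sub>1 t\<bar> > max (v\<^sub>0 0) (v\<^sub>1 0)) (at_left r)"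
    using bu unfolding blows_up_def T filterlim_at_top_dense real_of_ereal.simps by blast
  moreover have "eventually (\<lambda>t. t \<in> {0<..<r}) (at_left r)"
    using r by (rule eventually_at_left_real)
  ultimately have "eventually (\<lambda>t. False) (at_left r)"
  proof eventually_elim
    case (elim t)
    then have "0 < t" "t < r" by simp_all
    then show False using bound[of t] elim(1) by (meson not_le)
  qed
  then show False
    by simp
qed

end

theory Submission
  imports Defs
begin

text \<open>
  Put \<open>x = v\<^sub>0\<^bsup>-1/a\<^esup>\<close> and \<open>y = v\<^sub>1\<^bsup>-1/a\<^esup>\<close>. The system becomes \<open>x' = - y\<^bsup>-a\<^esup>\<close>, \<open>y' = - x\<^bsup>-a\<^esup>\<close>, so blow-up
  means that \<open>x\<close> or \<open>y\<close> reaches \<open>0\<close>. Both \<open>x\<^bsup>-a\<^esup> x'\<close> and \<open>y\<^bsup>-a\<^esup> y'\<close> equal \<open>- x\<^bsup>-a\<^esup> y\<^bsup>-a\<^esup>\<close>, hence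
  \<open>C = x\<^bsup>1-a\<^esup> - y\<^bsup>1-a\<^esup>\<close> is conserved (\<open>solution_conserved\<close>). By symmetry let \<open>C \<ge> 0\<close>, so that \<open>y\<close> is
  the smaller variable and \<open>v\<^sub>1\<close> the larger component. Eliminating \<open>x\<close> leaves the scalar
  autonomous equation \<open>y' = - 1 / h y\<close> with \<open>h y = x\<^bsup>a\<^esup> = (C + y\<^bsup>1-a\<^esup>)\<^bsup>a/(1-a)\<^esup>\<close> (\<open>pace\<close>).

  With \<open>H y = \<integral>\<^sub>0\<^bsup>y\<^esup> h\<close> (\<open>time_to_zero\<close>), the quantity \<open>H (y t) + t\<close> is constant (\<open>solution_remaining_time\<close>), so no solution
  outlives the time \<open>H (y 0)\<close>. Conversely, inverting \<open>H\<close> produces an explicit solution on all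
  of \<open>[0, H (y 0))\<close> that extends the given one (\<open>solution_by_quadrature\<close>); this takes the place of a
  local existence theorem. Maximality therefore gives \<open>t\<^sub>m\<^sub>a\<^sub>x = H (y 0)\<close> and
  \<open>H (y t) = t\<^sub>m\<^sub>a\<^sub>x - t\<close>, which forces \<open>y \<rightarrow> 0\<close> and thus blow-up of \<open>v\<^sub>1 = y\<^bsup>-a\<^esup>\<close>.

  Both rates come from \<open>H y \<le> y * h y\<close>, as \<open>h\<close> is increasing. Bounding \<open>h y\<close> by the constant
  \<open>h (y 0)\<close> yields \<open>t\<^sub>m\<^sub>a\<^sub>x - t \<le> const * y\<close>, that is \<open>v\<^sub>1 = O((t\<^sub>m\<^sub>a\<^sub>x - t)\<^bsup>-a\<^esup>)\<close>. For equal data \<open>C = 0\<close>, so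
  \<open>h y = y\<^bsup>a\<^esup>\<close> and \<open>t\<^sub>m\<^sub>a\<^sub>x - t \<le> y\<^bsup>a+1\<^esup>\<close>, that is \<open>v\<^sub>1 = O((t\<^sub>m\<^sub>a\<^sub>x - t)\<^bsup>-a/(a+1)\<^esup>)\<close>.
\<close>

section \<open>The scalar equation for the reduced variable\<close>

text \<open>
  The reduced variable \<open>y\<close> moves towards \<open>0\<close> with speed \<open>1 / pace a C y\<close>; the pace is the
  time spent per unit of distance.
\<close>
definition pace :: "real \<Rightarrow> real \<Rightarrow> real \<Rightarrow> real" where
  "pace a C s = (C + s powr (1 - a)) powr (a / (1 - a))"

text \<open>
  The integrand extends continuously to \<open>0\<close>, so the time is finite even though for \<open>C = 0\<close>
  the speed is unbounded near \<open>0\<close>.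
\<close>
definition time_to_zero :: "real \<Rightarrow> real \<Rightarrow> real \<Rightarrow> real" where
  "time_to_zero a C y = integral {0..y} (pace a C)"

context
  fixes a C :: real
  assumes a: "0 < a" "a < 1" and C: "0 \<le> C"
begin

lemma continuous_on_pace: "continuous_on {0..} (pace a C)"
  unfolding pace_def using a C
  by (intro continuous_intros continuous_on_powr') (auto intro: add_nonneg_nonneg)

lemma pace_pos: "0 < y \<Longrightarrow> 0 < pace a C y"
  using C by (simp add: pace_def) (metis add_nonneg_pos powr_gt_zero less_irrefl)

lemma pace_mono: "0 \<le> x \<Longrightarrow> x \<le> y \<Longrightarrow> pace a C x \<le> pace a C y"
  unfolding pace_def using a C by (intro powr_mono2) (auto intro: powr_mono2)

lemma time_to_zero_0: "time_to_zero a C 0 = 0"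
  by (simp add: time_to_zero_def)

lemma time_to_zero_has_derivative_within:
  assumes "0 \<le> y" "y \<le> b"
  shows "(time_to_zero a C has_real_derivative pace a C y) (at y within {0..b})"
  unfolding time_to_zero_def[abs_def] using assms
  by (intro integral_has_real_derivative continuous_on_subset[OF continuous_on_pace]) auto

lemma time_to_zero_has_derivative:
  assumes "0 < y"
  shows "(time_to_zero a C has_real_derivative pace a C y) (at y)"
  using time_to_zero_has_derivative_within[of y "y + 1"] assms at_within_Icc_at[of 0 y "y + 1"]
  by simp

lemma continuous_on_time_to_zero: "continuous_on {0..b} (time_to_zero a C)"
  by (rule DERIV_continuous_on[OF time_to_zero_has_derivative_within]) auto

lemma time_to_zero_strict_mono:
  assumes "0 \<le> x" "x < y"
  shows "time_to_zero a C x < time_to_zero a C y"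
proof (rule DERIV_pos_imp_increasing_open[OF assms(2)])
  show "\<exists>D. (time_to_zero a C has_real_derivative D) (at s) \<and> 0 < D" if "x < s" "s < y" for s
    using that assms time_to_zero_has_derivative[of s] pace_pos[of s] by auto
  show "continuous_on {x..y} (time_to_zero a C)"
    using assms by (intro continuous_on_subset[OF continuous_on_time_to_zero[of y]]) auto
qed

lemma time_to_zero_pos: "0 < y \<Longrightarrow> 0 < time_to_zero a C y"
  using time_to_zero_strict_mono[of 0 y] by (simp add: time_to_zero_0)

lemma time_to_zero_inj:
  assumes "0 \<le> x" "0 \<le> y" "time_to_zero a C x = time_to_zero a C y"
  shows "x = y"
  using assms time_to_zero_strict_mono[of x y] time_to_zero_strict_mono[of y x]
  by (cases x y rule: linorder_cases) auto

text \<open>The pace is increasing in \<open>y\<close>, so the slowest part of the way is its beginning.\<close>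
lemma time_to_zero_le:
  assumes "0 \<le> y"
  shows "time_to_zero a C y \<le> y * pace a C y"
proof -
  have "time_to_zero a C y \<le> integral {0..y} (\<lambda>_. pace a C y)"
    unfolding time_to_zero_def using assms
    by (intro integral_le integrable_continuous_interval
          continuous_on_subset[OF continuous_on_pace] pace_mono) auto
  then show ?thesis using assms by simp
qed

text \<open>
  The position as a function of the remaining time. The derivative is two-sided also at
  \<open>r = time_to_zero a C y0\<close>, which corresponds to the initial time; for this reason the
  inversion is carried out on an interval reaching beyond \<open>y0\<close>.
\<close>
lemma time_to_zero_inverse:
  assumes y0: "0 < y0"
  obtains g where "g (time_to_zero a C y0) = y0"
    and "\<And>r. 0 < r \<Longrightarrow> r \<le> time_to_zero a C y0 \<Longrightarrow>
           0 < g r \<and> time_to_zero a C (g r) = r \<and>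
           (g has_real_derivative inverse (pace a C (g r))) (at r)"
proof -
  let ?H = "time_to_zero a C"
  define b where "b = y0 + 1"
  have b: "0 < b" "y0 < b" using y0 by (auto simp: b_def)
  define g where "g = inv_into {0..b} ?H"
  have inj: "inj_on ?H {0..b}"
    by (auto intro!: inj_onI time_to_zero_inj)
  have gH: "g (?H y) = y" if "y \<in> {0..b}" for y
    unfolding g_def using inj that by (rule inv_into_f_f)
  have sub: "{0..?H b} \<subseteq> ?H ` {0..b}"
  proof
    fix r assume "r \<in> {0..?H b}"
    then show "r \<in> ?H ` {0..b}"
      using IVT'[of ?H 0 r b] b continuous_on_time_to_zero[of b] by (force simp: time_to_zero_0)
  qed
  have Hg: "?H (g r) = r" and g_mem: "g r \<in> {0..b}" if "r \<in> {0..?H b}" for r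
    using that sub unfolding g_def by (blast intro: f_inv_into_f inv_into_into)+
  have g_cont: "continuous_on {0..?H b} g"
    by (rule continuous_on_subset[OF _ sub], rule continuous_on_inv)
       (use continuous_on_time_to_zero gH in auto)
  have y0b: "?H y0 < ?H b" using b y0 by (intro time_to_zero_strict_mono) auto
  show thesis
  proof (rule that[of g])
    show "g (?H y0) = y0" using gH y0 b by simp
    fix r assume r: "0 < r" "r \<le> ?H y0"
    then have rb: "r < ?H b" using y0b by simp
    have "g r \<noteq> 0" using Hg[of r] r rb by (auto simp: time_to_zero_0)
    then have pos: "0 < g r" using g_mem[of r] r rb by auto
    have "isCont g r"
      using g_cont r rb by (intro continuous_on_interior[of "{0..?H b}"]) auto
    then have "(g has_real_derivative inverse (pace a C (g r))) (at r)"
      using r rb pos Hg pace_pos[OF pos]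
      by (intro DERIV_inverse_function[of ?H _ g r 0 "?H b"] time_to_zero_has_derivative) auto
    then show "0 < g r \<and> ?H (g r) = r \<and>
           (g has_real_derivative inverse (pace a C (g r))) (at r)"
      using pos Hg r rb by auto
  qed
qed

text \<open>
  Existence by quadrature: the scalar equation is solved by inverting the time function, and the
  companion component is recovered from the conserved quantity.
\<close>
lemma solution_by_quadrature:
  assumes y0: "0 < y0"
  obtains w where
    "\<forall>t\<in>{0..<time_to_zero a C y0}.
       0 < w t \<and> time_to_zero a C (w t) = time_to_zero a C y0 - t"
    "solution a (\<lambda>t. inverse (pace a C (w t))) (\<lambda>t. w t powr (- a)) (time_to_zero a C y0)"
proof -
  let ?H = "time_to_zero a C" let ?T = "time_to_zero a C y0"
  obtain g where g: "\<And>r. 0 < r \<Longrightarrow> r \<le> ?T \<Longrightarrow> 0 < g r \<and> ?H (g r) = r \<and>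
           (g has_real_derivative inverse (pace a C (g r))) (at r)"
    using time_to_zero_inverse[OF y0] by metis
  define w where "w t = g (?T - t)" for t
  have w: "0 < w t" "?H (w t) = ?T - t" if "0 \<le> t" "t < ?T" for t
    using g[of "?T - t"] that by (auto simp: w_def)
  have w': "(w has_real_derivative - inverse (pace a C (w t))) (at t)"
    if "0 \<le> t" "t < ?T" for t
  proof -
    have "((\<lambda>t. g (?T - t)) has_real_derivative inverse (pace a C (g (?T - t))) * (0 - 1)) (at t)"
      using g[of "?T - t"] that
      by (intro DERIV_chain'[where f = "\<lambda>t. ?T - t" and g = g] derivative_intros) auto
    then show ?thesis by (simp add: w_def[abs_def])
  qed
  have v0: "inverse (pace a C y) = (C + y powr (1 - a)) powr (- (a / (1 - a)))" for y
    by (simp add: pace_def powr_minus)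
  show thesis
  proof (rule that[of w])
    show "solution a (\<lambda>t. inverse (pace a C (w t))) (\<lambda>t. w t powr (- a)) ?T"
      unfolding solution_def
    proof (intro conjI allI impI)
      show "0 < ereal ?T" using time_to_zero_pos[OF y0] by simp
      fix t :: real assume "0 \<le> t \<and> ereal t < ereal ?T"
      then have t: "0 \<le> t" "t < ?T" by auto
      note pos = w(1)[OF t]
      define X where "X = C + w t powr (1 - a)"
      have X: "0 < X" using C pos by (auto simp: X_def intro: add_nonneg_pos)
      show "0 < inverse (pace a C (w t))" using pace_pos[OF pos] by simp
      show "0 < w t powr (- a)" using pos by simp
      have "((\<lambda>t. w t powr (- a)) has_real_derivative
          - a * w t powr (- a - 1) * - inverse (pace a C (w t))) (at t)"
        using DERIV_chain2[OF has_real_derivative_powr[OF pos, of "- a"] w'[OF t]] by simp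
      moreover have "w t powr (- a - 1) = (w t powr (- a)) powr ((a + 1) / a)"
        using a unfolding powr_powr
        by (intro arg_cong[where f = "(powr) (w t)"]) (simp add: field_simps)
      ultimately show "((\<lambda>t. w t powr (- a)) has_real_derivative
          a * (w t powr (- a)) powr ((a + 1) / a) * inverse (pace a C (w t)))
          (at t within {s. 0 \<le> s \<and> ereal s < ereal ?T})"
        by (simp add: has_field_derivative_at_within)
      have "((\<lambda>t. C + w t powr (1 - a)) has_real_derivative
          (1 - a) * w t powr (- a) * - inverse (pace a C (w t))) (at t)"
        using DERIV_add[OF DERIV_const[of C]
            DERIV_chain2[OF has_real_derivative_powr[OF pos, of "1 - a"] w'[OF t]]] by simp
      then have "((\<lambda>t. (C + w t powr (1 - a)) powr (- (a / (1 - a)))) has_real_derivative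
          - (a / (1 - a)) * X powr (- (a / (1 - a)) - 1)
           * ((1 - a) * w t powr (- a) * - inverse (pace a C (w t)))) (at t)"
        using X unfolding X_def by (intro DERIV_chain2[OF has_real_derivative_powr])
      moreover have "- (a / (1 - a)) * X powr (- (a / (1 - a)) - 1)
           * ((1 - a) * w t powr (- a) * - inverse (pace a C (w t)))
          = a * (X powr (- (a / (1 - a)) - 1) * X powr (- (a / (1 - a)))) * w t powr (- a)"
        using a unfolding v0 X_def by (simp add: field_simps)
      moreover have "X powr (- (a / (1 - a)) - 1) * X powr (- (a / (1 - a)))
          = (X powr (- (a / (1 - a)))) powr ((a + 1) / a)"
        using a unfolding powr_add[symmetric] powr_powr
        by (intro arg_cong[where f = "(powr) X"]) (simp add: field_simps)
      ultimately show "((\<lambda>t. inverse (pace a C (w t))) has_real_derivative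
          a * inverse (pace a C (w t)) powr ((a + 1) / a) * w t powr (- a))
          (at t within {s. 0 \<le> s \<and> ereal s < ereal ?T})"
        unfolding v0 X_def by (simp add: has_field_derivative_at_within)
    qed
  qed (use w in auto)
qed

end

section \<open>Symmetry and conservation laws of solutions\<close>

lemma solution_swap: "solution a v\<^sub>0 v\<^sub>1 T \<longleftrightarrow> solution a v\<^sub>1 v\<^sub>0 T"
  unfolding solution_def by blast

lemma maximal_solution_swap: "maximal_solution a v\<^sub>0 v\<^sub>1 T \<Longrightarrow> maximal_solution a v\<^sub>1 v\<^sub>0 T"
  unfolding maximal_solution_def using solution_swap by blast

lemma blows_up_with_rate_swap:
  "blows_up_with_rate v\<^sub>0 v\<^sub>1 T g \<longleftrightarrow> blows_up_with_rate v\<^sub>1 v\<^sub>0 T g"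
  unfolding blows_up_with_rate_def blows_up_def by (simp add: max.commute)

lemma constant_on_lifespan:
  assumes "\<And>t. 0 \<le> t \<Longrightarrow> ereal t < T \<Longrightarrow>
      (f has_real_derivative 0) (at t within {s. 0 \<le> s \<and> ereal s < T})"
    and "0 \<le> t" "ereal t < T"
  shows "f t = f 0"
proof -
  let ?S = "{s. 0 \<le> s \<and> ereal s < T}"
  have "is_interval ?S"
    unfolding is_interval_1 by (auto intro: le_less_trans[of "ereal _" "ereal _"])
  then have "convex ?S" by (simp add: is_interval_convex)
  moreover have "0 \<in> ?S" using assms(2,3) by (auto intro: le_less_trans[of _ "ereal t"])
  ultimately show ?thesis
    using has_field_derivative_zero_constant[of ?S f] assms by (metis (mono_tags, lifting) mem_Collect_eq)
qed

text \<open>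
  With \<open>x = v\<^sub>0\<^bsup>-1/a\<^esup>\<close> and \<open>y = v\<^sub>1\<^bsup>-1/a\<^esup>\<close> this is the conservation of \<open>x\<^bsup>1-a\<^esup> - y\<^bsup>1-a\<^esup>\<close>: either term has
  derivative \<open>(a - 1) v\<^sub>0 v\<^sub>1\<close>, an expression symmetric in the two components.
\<close>
lemma solution_conserved:
  assumes sol: "solution a v\<^sub>0 v\<^sub>1 T" and a: "0 < a" and t: "0 \<le> t" "ereal t < T"
  shows "v\<^sub>0 t powr ((a - 1) / a) - v\<^sub>1 t powr ((a - 1) / a)
       = v\<^sub>0 0 powr ((a - 1) / a) - v\<^sub>1 0 powr ((a - 1) / a)"
proof (rule constant_on_lifespan[OF _ t])
  let ?S = "{s. 0 \<le> s \<and> ereal s < T}"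
  fix s :: real assume s: "0 \<le> s" "ereal s < T"
  have *: "((\<lambda>t. u t powr ((a - 1) / a)) has_real_derivative (a - 1) * (u s * z)) (at s within ?S)"
    if "0 < u s" "(u has_real_derivative a * u s powr ((a + 1) / a) * z) (at s within ?S)"
    for u :: "real \<Rightarrow> real" and z
  proof -
    let ?D = "(a - 1) / a * u s powr ((a - 1) / a - 1) * (a * u s powr ((a + 1) / a) * z)"
    have D: "((\<lambda>t. u t powr ((a - 1) / a)) has_real_derivative ?D) (at s within ?S)"
      using DERIV_chain2[OF has_real_derivative_powr[OF that(1)] that(2)] .
    have "?D = (a - 1) / a * a * (u s powr ((a - 1) / a - 1) * u s powr ((a + 1) / a)) * z"
      by simp
    moreover have "u s powr ((a - 1) / a - 1) * u s powr ((a + 1) / a) = u s"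
      using that(1) a by (simp add: powr_add[symmetric] field_simps)
    ultimately have "?D = (a - 1) * (u s * z)" using a by simp
    with D show ?thesis by simp
  qed
  show "((\<lambda>t. v\<^sub>0 t powr ((a - 1) / a) - v\<^sub>1 t powr ((a - 1) / a)) has_real_derivative 0) (at s within ?S)"
    using DERIV_diff[OF *[of v\<^sub>0 "v\<^sub>1 s"] *[of v\<^sub>1 "v\<^sub>0 s"]] sol s
    by (simp add: solution_def mult.commute)
qed

text \<open>
  The first identity is the conservation law solved for \<open>v\<^sub>0\<close>. Because \<open>v\<^sub>1\<^bsup>-1/a\<^esup>\<close> has derivative
  \<open>- v\<^sub>0\<close>, it says that the reduced variable moves with speed \<open>1 / pace\<close>, so its remaining time
  decreases at unit rate.
\<close>
lemma solution_remaining_time: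
  assumes sol: "solution a v\<^sub>0 v\<^sub>1 T" and a: "0 < a" "a < 1"
    and C: "C = v\<^sub>0 0 powr ((a - 1) / a) - v\<^sub>1 0 powr ((a - 1) / a)" "0 \<le> C"
    and t: "0 \<le> t" "ereal t < T"
  shows "pace a C (v\<^sub>1 t powr (- 1 / a)) = inverse (v\<^sub>0 t)"
    and "time_to_zero a C (v\<^sub>1 t powr (- 1 / a)) = time_to_zero a C (v\<^sub>1 0 powr (- 1 / a)) - t"
proof -
  let ?S = "{s. 0 \<le> s \<and> ereal s < T}"
  have speed: "pace a C (v\<^sub>1 t powr (- 1 / a)) = inverse (v\<^sub>0 t)"
    if t: "0 \<le> t" "ereal t < T" for t
  proof -
    have pos: "0 < v\<^sub>0 t" using sol t by (auto simp: solution_def)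
    have "(v\<^sub>1 t powr (- 1 / a)) powr (1 - a) = v\<^sub>1 t powr ((a - 1) / a)"
      using a unfolding powr_powr by (intro arg_cong[where f = "(powr) (v\<^sub>1 t)"]) (simp add: field_simps)
    moreover have "C + v\<^sub>1 t powr ((a - 1) / a) = v\<^sub>0 t powr ((a - 1) / a)"
      using solution_conserved[OF sol a(1) t] unfolding C(1) by simp
    ultimately have "pace a C (v\<^sub>1 t powr (- 1 / a)) = (v\<^sub>0 t powr ((a - 1) / a)) powr (a / (1 - a))"
      by (simp only: pace_def)
    also have "\<dots> = v\<^sub>0 t powr (- 1)"
      using a unfolding powr_powr by (intro arg_cong[where f = "(powr) (v\<^sub>0 t)"]) (simp add: field_simps)
    finally show ?thesis using pos by (simp add: powr_minus)
  qed
  have "time_to_zero a C (v\<^sub>1 t powr (- 1 / a)) + t = time_to_zero a C (v\<^sub>1 0 powr (- 1 / a)) + 0"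
  proof (rule constant_on_lifespan[OF _ t])
    fix s :: real assume s: "0 \<le> s" "ereal s < T"
    have pos: "0 < v\<^sub>0 s" "0 < v\<^sub>1 s" using sol s by (auto simp: solution_def)
    have "(v\<^sub>1 has_real_derivative a * v\<^sub>1 s powr ((a + 1) / a) * v\<^sub>0 s) (at s within ?S)"
      using sol s by (auto simp: solution_def)
    then have "((\<lambda>t. v\<^sub>1 t powr (- 1 / a)) has_real_derivative
        - 1 / a * v\<^sub>1 s powr (- 1 / a - 1) * (a * v\<^sub>1 s powr ((a + 1) / a) * v\<^sub>0 s)) (at s within ?S)"
      by (rule DERIV_chain2[where g = v\<^sub>1, OF has_real_derivative_powr[OF pos(2)]])
    moreover have "v\<^sub>1 s powr (- 1 / a - 1) * v\<^sub>1 s powr ((a + 1) / a) = 1"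
      using pos a by (simp add: powr_add[symmetric] field_simps)
    ultimately have "((\<lambda>t. v\<^sub>1 t powr (- 1 / a)) has_real_derivative - v\<^sub>0 s) (at s within ?S)"
      using a by (simp add: field_simps)
    then have "((\<lambda>t. time_to_zero a C (v\<^sub>1 t powr (- 1 / a)) + t) has_real_derivative
        pace a C (v\<^sub>1 s powr (- 1 / a)) * - v\<^sub>0 s + 1) (at s within ?S)"
      using time_to_zero_has_derivative[OF a C(2), of "v\<^sub>1 s powr (- 1 / a)"] pos
      by (intro DERIV_add DERIV_ident DERIV_chain2[where f = "time_to_zero a C"]) auto
    then show "((\<lambda>t. time_to_zero a C (v\<^sub>1 t powr (- 1 / a)) + t) has_real_derivative 0) (at s within ?S)"
      using speed[OF s] pos by simp
  qed
  then show "time_to_zero a C (v\<^sub>1 t powr (- 1 / a)) = time_to_zero a C (v\<^sub>1 0 powr (- 1 / a)) - t"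
    by simp
  show "pace a C (v\<^sub>1 t powr (- 1 / a)) = inverse (v\<^sub>0 t)"
    by (rule speed[OF t])
qed

section \<open>Lifespan and blow-up rates\<close>

text \<open>
  The remaining time stays positive, which bounds the lifespan from above. The explicit solution
  with the same data has the same remaining time and the same conserved quantity, hence agrees with
  the given one as long as the latter exists; maximality bounds the lifespan from below.
\<close>
lemma maximal_solution_lifespan:
  assumes max: "maximal_solution a v\<^sub>0 v\<^sub>1 T" and a: "0 < a" "a < 1"
    and C: "C = v\<^sub>0 0 powr ((a - 1) / a) - v\<^sub>1 0 powr ((a - 1) / a)" "0 \<le> C"
    and pos: "0 < v\<^sub>1 0"
  shows "T = time_to_zero a C (v\<^sub>1 0 powr (- 1 / a))"
proof (rule antisym)
  let ?H = "time_to_zero a C" and ?y = "\<lambda>t. v\<^sub>1 t powr (- 1 / a)"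
  have sol: "solution a v\<^sub>0 v\<^sub>1 T" using max by (simp add: maximal_solution_def)
  have v_pos: "0 < v\<^sub>0 t" "0 < v\<^sub>1 t" if "0 \<le> t" "ereal t < T" for t
    using sol that by (auto simp: solution_def)
  note remaining = solution_remaining_time[OF sol a C]
  have before: "t < ?H (?y 0)" if "0 \<le> t" "ereal t < T" for t
    using remaining(2)[OF that] time_to_zero_pos[OF a C(2), of "?y t"] v_pos[OF that] by simp
  have y0: "0 < ?y 0" using pos by simp
  from time_to_zero_pos[OF a C(2) y0] show "T \<le> ?H (?y 0)"
    using before[of "?H (?y 0)"] by (meson less_irrefl less_le not_le)
  obtain w where w: "\<forall>t\<in>{0..<?H (?y 0)}. 0 < w t \<and> ?H (w t) = ?H (?y 0) - t"
    and w_sol: "solution a (\<lambda>t. inverse (pace a C (w t))) (\<lambda>t. w t powr (- a)) (?H (?y 0))"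
    using solution_by_quadrature[OF a C(2) y0] by blast
  have "inverse (pace a C (w t)) = v\<^sub>0 t \<and> w t powr (- a) = v\<^sub>1 t"
    if t: "0 \<le> t" "ereal t < T" for t
  proof -
    have "0 < w t" "?H (w t) = ?H (?y t)"
      using bspec[OF w, of t] t(1) before[OF t] unfolding remaining(2)[OF t] by simp_all
    then have "w t = ?y t"
      using time_to_zero_inj[OF a C(2), of "w t" "?y t"] by simp
    then show ?thesis
      using remaining(1)[OF t] v_pos[OF t] a by (simp add: powr_powr)
  qed
  then show "?H (?y 0) \<le> T"
    using max w_sol unfolding maximal_solution_def by blast
qed

text \<open>
  The ordering of the data persists, so \<open>v\<^sub>1\<close> alone controls the maximum, and every statement about
  \<open>v\<^sub>1 = y\<^bsup>-a\<^esup>\<close> is read off from the fact that \<open>y\<close> has remaining time \<open>r - t\<close>.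
\<close>
lemma blow_up_of_larger_component:
  assumes max: "maximal_solution a v\<^sub>0 v\<^sub>1 T" and a: "0 < a" "a < 1"
    and pos: "0 < v\<^sub>0 0" and le: "v\<^sub>0 0 \<le> v\<^sub>1 0"
  shows "blows_up_with_rate v\<^sub>0 v\<^sub>1 T (\<lambda>t. (real_of_ereal T - t) powr (- a))"
    and "v\<^sub>0 0 = v\<^sub>1 0 \<Longrightarrow>
      blows_up_with_rate v\<^sub>0 v\<^sub>1 T (\<lambda>t. (real_of_ereal T - t) powr (- a / (a + 1)))"
proof -
  define C where "C = v\<^sub>0 0 powr ((a - 1) / a) - v\<^sub>1 0 powr ((a - 1) / a)"
  define y where "y t = v\<^sub>1 t powr (- 1 / a)" for t
  define r where "r = time_to_zero a C (y 0)"
  have C: "0 \<le> C"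
    unfolding C_def using a pos le by (simp add: powr_mono2' divide_nonpos_pos)
  have T: "T = ereal r"
    using maximal_solution_lifespan[OF max a C_def C] pos le by (simp add: r_def y_def)
  have sol: "solution a v\<^sub>0 v\<^sub>1 T" using max by (simp add: maximal_solution_def)
  have r: "0 < r" using sol by (simp add: solution_def T)
  have v_pos: "0 < v\<^sub>0 t" "0 < v\<^sub>1 t" if "0 \<le> t" "t < r" for t
    using sol that by (auto simp: solution_def T)
  have y_pos: "0 < y t" if "0 \<le> t" "t < r" for t
    using v_pos[OF that] by (simp add: y_def)
  have v1: "v\<^sub>1 t = y t powr (- a)" if "0 \<le> t" "t < r" for t
    using v_pos[OF that] a by (simp add: y_def powr_powr)
  have speed: "pace a C (y t) = inverse (v\<^sub>0 t)"
    and time: "time_to_zero a C (y t) = r - t" if "0 \<le> t" "t < r" for t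
    using solution_remaining_time[OF sol a C_def C, of t] that by (auto simp: T y_def r_def)
  have larger: "max \<bar>v\<^sub>0 t\<bar> \<bar>v\<^sub>1 t\<bar> = v\<^sub>1 t" if t: "0 \<le> t" "t < r" for t
  proof -
    have "inverse (v\<^sub>1 t) = (y t powr (1 - a)) powr (a / (1 - a))"
      using v1[OF t] a by (simp add: powr_powr powr_minus)
    also have "\<dots> \<le> pace a C (y t)"
      unfolding pace_def using a C by (intro powr_mono2) auto
    finally have "v\<^sub>0 t \<le> v\<^sub>1 t"
      using speed[OF t] v_pos[OF t] by simp
    then show ?thesis using v_pos[OF t] by simp
  qed
  have near: "eventually (\<lambda>t. t \<in> {s<..<r}) (at_left r)" if "s < r" for s
    using that by (rule eventually_at_left_real)
  have blow_up: "blows_up v\<^sub>0 v\<^sub>1 T"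
    unfolding blows_up_def T real_of_ereal.simps
  proof (intro conjI filterlim_at_top_gt[of _ _ 0, THEN iffD2] allI impI)
    show "ereal r < \<infinity>" by simp
    fix Z :: real assume Z: "0 < Z"
    \<comment> \<open>the position at which \<open>v\<^sub>1\<close> takes the value \<open>Z\<close>\<close>
    define \<epsilon> where "\<epsilon> = Z powr (- 1 / a)"
    have eps: "0 < \<epsilon>" using Z by (simp add: \<epsilon>_def)
    have "max 0 (r - time_to_zero a C \<epsilon>) < r"
      using r time_to_zero_pos[OF a C eps] by simp
    from near[OF this] show "\<forall>\<^sub>F t in at_left r. Z \<le> max \<bar>v\<^sub>0 t\<bar> \<bar>v\<^sub>1 t\<bar>"
    proof eventually_elim
      case (elim t)
      then have t: "0 \<le> t" "t < r" and "time_to_zero a C (y t) < time_to_zero a C \<epsilon>"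
        using time[of t] by auto
      then have "y t \<le> \<epsilon>"
        using time_to_zero_strict_mono[OF a C, of \<epsilon> "y t"] eps by force
      then have "\<epsilon> powr (- a) \<le> y t powr (- a)"
        using y_pos[OF t] a by (intro powr_mono2') auto
      then show ?case
        using larger[OF t] v1[OF t] Z a by (simp add: \<epsilon>_def powr_powr)
    qed
  qed
  have rate: "blows_up_with_rate v\<^sub>0 v\<^sub>1 T (\<lambda>t. (real_of_ereal T - t) powr p)"
    if bound: "\<And>t. 0 \<le> t \<Longrightarrow> t < r \<Longrightarrow> v\<^sub>1 t \<le> k * (r - t) powr p" for k p
    unfolding blows_up_with_rate_def
  proof (intro conjI blow_up)
    have "eventually (\<lambda>t. norm (max \<bar>v\<^sub>0 t\<bar> \<bar>v\<^sub>1 t\<bar>) \<le> k * norm ((r - t) powr p)) (at_left r)"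
      using near[OF r]
    proof eventually_elim
      case (elim t)
      then show ?case using larger[of t] bound[of t] v_pos[of t] by simp
    qed
    then show "(\<lambda>t. max \<bar>v\<^sub>0 t\<bar> \<bar>v\<^sub>1 t\<bar>)
        \<in> O[at_left (real_of_ereal T)](\<lambda>t. (real_of_ereal T - t) powr p)"
      unfolding T real_of_ereal.simps by (rule bigoI)
  qed
  show "blows_up_with_rate v\<^sub>0 v\<^sub>1 T (\<lambda>t. (real_of_ereal T - t) powr (- a))"
  proof (rule rate[of "pace a C (y 0) powr a"])
    fix t assume t: "0 \<le> t" "t < r"
    let ?h = "pace a C (y 0)"
    have h: "0 < ?h" using pace_pos[OF a C] y_pos[of 0] r by simp
    have "y t \<le> y 0"
      using time_to_zero_strict_mono[OF a C, of "y 0" "y t"] time[OF t] t y_pos[of 0] r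
      by (force simp: r_def)
    then have "pace a C (y t) \<le> ?h"
      using y_pos[OF t] by (intro pace_mono[OF a C]) auto
    then have "r - t \<le> y t * ?h"
      using time_to_zero_le[OF a C, of "y t"] time[OF t] y_pos[OF t]
      by (smt (verit) mult_left_mono)
    then have "(r - t) / ?h \<le> y t" using h by (simp add: divide_le_eq)
    then have "v\<^sub>1 t \<le> ((r - t) / ?h) powr (- a)"
      unfolding v1[OF t] using a t h by (intro powr_mono2') auto
    also have "\<dots> = ?h powr a * (r - t) powr (- a)"
      using t h by (simp add: powr_divide powr_minus field_simps)
    finally show "v\<^sub>1 t \<le> ?h powr a * (r - t) powr (- a)" .
  qed
  show "blows_up_with_rate v\<^sub>0 v\<^sub>1 T (\<lambda>t. (real_of_ereal T - t) powr (- a / (a + 1)))"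
    if eq: "v\<^sub>0 0 = v\<^sub>1 0"
  proof (rule rate[of 1])
    fix t assume t: "0 \<le> t" "t < r"
    have "pace a C (y t) = y t powr a"
      using eq a by (simp add: pace_def C_def powr_powr)
    then have "r - t \<le> y t powr (a + 1)"
      using time_to_zero_le[OF a C, of "y t"] time[OF t] y_pos[OF t]
      by (simp add: powr_add mult.commute)
    then have "(y t powr (a + 1)) powr (- a / (a + 1)) \<le> (r - t) powr (- a / (a + 1))"
      using a t by (intro powr_mono2') auto
    then show "v\<^sub>1 t \<le> 1 * (r - t) powr (- a / (a + 1))"
      using v1[OF t] a by (simp add: powr_powr)
  qed
qed

theorem theorem4p7:
  fixes a :: real and v\<^sub>0 v\<^sub>1 :: "real \<Rightarrow> real" and t_max :: ereal
  assumes "0 < a" and "a < 1"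
    and "maximal_solution a v\<^sub>0 v\<^sub>1 t_max"
    and "v\<^sub>0 0 > 0" and "v\<^sub>1 0 > 0"
  shows "(v\<^sub>0 0 = v\<^sub>1 0 \<longrightarrow>
            blows_up_with_rate v\<^sub>0 v\<^sub>1 t_max
              (\<lambda>t. (real_of_ereal t_max - t) powr (- a / (a + 1)))) \<and>
         (v\<^sub>0 0 \<noteq> v\<^sub>1 0 \<longrightarrow>
            blows_up_with_rate v\<^sub>0 v\<^sub>1 t_max
              (\<lambda>t. (real_of_ereal t_max - t) powr (- a)))"
proof (cases "v\<^sub>0 0 \<le> v\<^sub>1 0")
  case True
  then show ?thesis
    using blow_up_of_larger_component[OF assms(3) assms(1,2,4)] by simp
next
  case False
  then have "blows_up_with_rate v\<^sub>1 v\<^sub>0 t_max (\<lambda>t. (real_of_ereal t_max - t) powr (- a))"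
    using blow_up_of_larger_component(1)[OF maximal_solution_swap[OF assms(3)] assms(1,2,5)]
    by simp
  then show ?thesis
    using False by (simp add: blows_up_with_rate_swap[of v\<^sub>0])
qed

end
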